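(* (i) For every orthomodular poset $\mathbf P$ of finite height, $\mathbb P(\mathbb I(\mathbf P))=\mathbf P$. (ii) For every implication orthomodular poset $\mathbf I$ of finite height satisfying condition (C), $\mathbb I(\mathbb P(\mathbf I))=\mathbf I$.
   Context: Orthomodular poset: $(P,\leq,{}',0,1)$ with $(P,\leq,0,1)$ a bounded poset, $'$ an antitone involution, such that the supremum $x\vee y$ exists whenever $x\leq y'$, $x\vee x'=1$, $x\wedge x'=0$, and $x\leq y$ implies $(y'\vee x)'\vee x=y$; finite height: every chain finite. For such $\mathbf P$ of finite height, $\mathbb I(\mathbf P):=(P,\rightarrow,0)$ where $x\rightarrow y:=y\vee\operatorname{Max}L(x',y')=\{y\vee t\mid t \text{ a maximal common lower bound of } x',y'\}$. An implication orthomodular poset is a triple $(I,\rightarrow,0)$ with $0\in I$ and $\rightarrow:I^2\to$ nonempty subsets of $I$, with $x':=x\rightarrow0$, $1:=0'$; singletons are identified with their elements, subsets as arguments of $\rightarrow$ are treated elementwise, and $A\rightarrow B=1$ for subsets means for every $a\in A$ there is $b\in B$ with $a\rightarrow b=1$; satisfying for all $x,y,z$: (O1) $0\rightarrow x=x\rightarrow x=1$; (O2) $x\rightarrow y=y\rightarrow x=1\Rightarrow x=y$; (O3) $x\rightarrow y=y\rightarrow z=1\Rightarrow x\rightarrow z=1$; (O4) $x''=x$; (O5) $x\rightarrow y=1\Rightarrow(y\rightarrow z)\rightarrow(x\rightarrow z)=1$; (O6) $x\rightarrow y=1\Rightarrow(((y'\rightarrow x)\rightarrow x)'\rightarrow x)\rightarrow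 x=y$; (O7) $x\rightarrow y'=1\Rightarrow x\rightarrow((x\rightarrow y)\rightarrow y)=y\rightarrow((x\rightarrow y)\rightarrow y)=1$; (O8) $x\rightarrow y'=x\rightarrow z=y\rightarrow z=1\Rightarrow((x\rightarrow y)\rightarrow y)\rightarrow z=1$; (O9) $(x'\rightarrow x)\rightarrow x=1$; (O10) $x\rightarrow(y\rightarrow x)=1$. It has finite height if there is no infinite sequence of pairwise different $a_n$ with $a_n\rightarrow a_{n+1}=1$ for all $n$. For such $\mathbf I$ of finite height, $\mathbb P(\mathbf I):=(I,\leq,{}',0,1)$ where $x\leq y$ iff $x\rightarrow y=1$, $x'=x\rightarrow0$, $1=0'$ (this is an orthomodular poset of finite height). Condition (C) for $(I,\rightarrow,0)$: for all $x,y\in I$, $x\rightarrow y=\{(y\rightarrow u)\rightarrow u\mid u\in I,\ u\rightarrow x'=u\rightarrow y'=1,\ \text{and } u=w \text{ for all } w\in I \text{ with } u\rightarrow w=w\rightarrow x'=w\rightarrow y'=1\}$. *)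

theory Defs
  imports Main "HOL-Library.FuncSet"
begin

text \<open>
  Structures live on an explicit carrier. Order relations are subsets of carrier \<open>\<times>\<close> carrier, and
  operations are extensional functions (\<^const>\<open>undefined\<close> off the carrier), so that equality of
  structures is equality of records.
\<close>

subsection \<open>Orthomodular posets\<close>

record 'a bounded_poset_compl =
  elems :: "'a set"
  ord_rel :: "'a rel"
  compl :: "'a \<Rightarrow> 'a"
  bottom :: 'a
  topmost :: 'a

definition is_supremum :: "'a rel \<Rightarrow> 'a set \<Rightarrow> 'a \<Rightarrow> bool" where
  "is_supremum r A s \<longleftrightarrow> s \<in> Above r A \<and> (\<forall>u\<in>Above r A. (s, u) \<in> r)"

definition is_infimum :: "'a rel \<Rightarrow> 'a set \<Rightarrow> 'a \<Rightarrow> bool" where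
  "is_infimum r A s \<longleftrightarrow> s \<in> Under r A \<and> (\<forall>l\<in>Under r A. (l, s) \<in> r)"

text \<open>The partial join; meaningful only where the supremum exists.\<close>

definition join :: "'a rel \<Rightarrow> 'a \<Rightarrow> 'a \<Rightarrow> 'a" where
  "join r x y = (THE s. is_supremum r {x, y} s)"

definition maximal_elements :: "'a rel \<Rightarrow> 'a set \<Rightarrow> 'a set" where
  "maximal_elements r A = {m \<in> A. \<forall>a\<in>A. (m, a) \<in> r \<longrightarrow> a = m}"

locale orthomodular_poset =
  fixes P :: "'a bounded_poset_compl"
  assumes partial_order: "partial_order_on (elems P) (ord_rel P)"
    and bottom_mem: "bottom P \<in> elems P"
    and topmost_mem: "topmost P \<in> elems P"
    and bottom_least: "x \<in> elems P \<Longrightarrow> (bottom P, x) \<in> ord_rel P"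
    and topmost_greatest: "x \<in> elems P \<Longrightarrow> (x, topmost P) \<in> ord_rel P"
    and compl_fun: "compl P \<in> elems P \<rightarrow>\<^sub>E elems P"
    and compl_antitone: "(x, y) \<in> ord_rel P \<Longrightarrow> (compl P y, compl P x) \<in> ord_rel P"
    and compl_involution: "x \<in> elems P \<Longrightarrow> compl P (compl P x) = x"
    and orthogonal_join_exists:
      "\<lbrakk>x \<in> elems P; y \<in> elems P; (x, compl P y) \<in> ord_rel P\<rbrakk>
        \<Longrightarrow> \<exists>s. is_supremum (ord_rel P) {x, y} s"
    and sup_compl: "x \<in> elems P \<Longrightarrow> is_supremum (ord_rel P) {x, compl P x} (topmost P)"
    and inf_compl: "x \<in> elems P \<Longrightarrow> is_infimum (ord_rel P) {x, compl P x} (bottom P)"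
    \<comment> \<open>both joins below exist by \<open>orthogonal_join_exists\<close>\<close>
    and orthomodular_law:
      "(x, y) \<in> ord_rel P
        \<Longrightarrow> join (ord_rel P) (compl P (join (ord_rel P) (compl P y) x)) x = y"

definition poset_finite_height :: "'a bounded_poset_compl \<Rightarrow> bool" where
  "poset_finite_height P \<longleftrightarrow> (\<forall>C\<in>Chains (ord_rel P). finite C)"


subsection \<open>Implication orthomodular posets\<close>

record 'a implication_structure =
  carr :: "'a set"
  imp :: "'a \<Rightarrow> 'a \<Rightarrow> 'a set"
  zero :: 'a

text \<open>
  Expressions in the axioms are set-valued: an element \<open>x\<close> is represented by \<open>{x}\<close>, and \<open>imps\<close> is
  the elementwise extension of the implication.
\<close>

definition imps :: "'a implication_structure \<Rightarrow> 'a set \<Rightarrow> 'a set \<Rightarrow> 'a set" where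
  "imps I A B = (\<Union>a\<in>A. \<Union>b\<in>B. imp I a b)"

definition neg :: "'a implication_structure \<Rightarrow> 'a set \<Rightarrow> 'a set" where
  "neg I A = imps I A {zero I}"

definition unit :: "'a implication_structure \<Rightarrow> 'a set" where
  "unit I = imp I (zero I) (zero I)"

text \<open>
  \<open>imp1 I A B\<close> renders \<open>A \<rightarrow> B = 1\<close> for subsets; this is a convention of its own and not the
  equation \<open>imps I A B = unit I\<close>.
\<close>

definition imp1 :: "'a implication_structure \<Rightarrow> 'a set \<Rightarrow> 'a set \<Rightarrow> bool" where
  "imp1 I A B \<longleftrightarrow> (\<forall>a\<in>A. \<exists>b\<in>B. imp I a b = unit I)"

locale implication_orthomodular_poset =
  fixes I :: "'a implication_structure"
  assumes zero_mem: "zero I \<in> carr I"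
    and imp_fun: "imp I \<in> carr I \<rightarrow>\<^sub>E carr I \<rightarrow>\<^sub>E (Pow (carr I) - {{}})"
    and O1: "x \<in> carr I \<Longrightarrow> imp I (zero I) x = unit I \<and> imp I x x = unit I"
    and O2: "\<lbrakk>x \<in> carr I; y \<in> carr I; imp I x y = unit I; imp I y x = unit I\<rbrakk> \<Longrightarrow> x = y"
    and O3: "\<lbrakk>x \<in> carr I; y \<in> carr I; z \<in> carr I; imp I x y = unit I; imp I y z = unit I\<rbrakk>
      \<Longrightarrow> imp I x z = unit I"
    and O4: "x \<in> carr I \<Longrightarrow> neg I (neg I {x}) = {x}"
    and O5: "\<lbrakk>x \<in> carr I; y \<in> carr I; z \<in> carr I; imp I x y = unit I\<rbrakk>
      \<Longrightarrow> imp1 I (imp I y z) (imp I x z)"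
    and O6: "\<lbrakk>x \<in> carr I; y \<in> carr I; imp I x y = unit I\<rbrakk>
      \<Longrightarrow> imps I (imps I (neg I (imps I (imps I (neg I {y}) {x}) {x})) {x}) {x} = {y}"
    and O7: "\<lbrakk>x \<in> carr I; y \<in> carr I; imp1 I {x} (neg I {y})\<rbrakk>
      \<Longrightarrow> imp1 I {x} (imps I (imp I x y) {y}) \<and> imp1 I {y} (imps I (imp I x y) {y})"
    and O8: "\<lbrakk>x \<in> carr I; y \<in> carr I; z \<in> carr I;
        imp1 I {x} (neg I {y}); imp I x z = unit I; imp I y z = unit I\<rbrakk>
      \<Longrightarrow> imp1 I (imps I (imp I x y) {y}) {z}"
    and O9: "x \<in> carr I \<Longrightarrow> imp1 I (imps I (neg I {x}) {x}) {x}"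
    and O10: "\<lbrakk>x \<in> carr I; y \<in> carr I\<rbrakk> \<Longrightarrow> imp1 I {x} (imp I y x)"

definition impl_finite_height :: "'a implication_structure \<Rightarrow> bool" where
  "impl_finite_height I \<longleftrightarrow>
    \<not> (\<exists>a :: nat \<Rightarrow> 'a. range a \<subseteq> carr I \<and> inj a \<and> (\<forall>n. imp I (a n) (a (Suc n)) = unit I))"

text \<open>
  For the \<open>u\<close> admitted in condition (C), \<open>(y \<rightarrow> u) \<rightarrow> u\<close> is a singleton by O4--O7, so the union
  is the set of its values.
\<close>

definition condition_C :: "'a implication_structure \<Rightarrow> bool" where
  "condition_C I \<longleftrightarrow> (\<forall>x\<in>carr I. \<forall>y\<in>carr I.
    imp I x y = \<Union> {imps I (imp I y u) {u} | u. u \<in> carr I \<and>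
      imp1 I {u} (neg I {x}) \<and> imp1 I {u} (neg I {y}) \<and>
      (\<forall>w\<in>carr I. imp I u w = unit I \<and> imp1 I {w} (neg I {x}) \<and> imp1 I {w} (neg I {y})
        \<longrightarrow> u = w)})"


subsection \<open>The two constructions\<close>

definition to_implication :: "'a bounded_poset_compl \<Rightarrow> 'a implication_structure" where
  "to_implication P = \<lparr>
    carr = elems P,
    imp = (\<lambda>x\<in>elems P. \<lambda>y\<in>elems P.
      {join (ord_rel P) y t | t.
        t \<in> maximal_elements (ord_rel P) (Under (ord_rel P) {compl P x, compl P y})}),
    zero = bottom P\<rparr>"

text \<open>By O4, \<open>x \<rightarrow> 0\<close> is always a singleton, which justifies \<^const>\<open>the_elem\<close>.\<close>

definition to_poset :: "'a implication_structure \<Rightarrow> 'a bounded_poset_compl" where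
  "to_poset I = \<lparr>
    elems = carr I,
    ord_rel = {(x, y). x \<in> carr I \<and> y \<in> carr I \<and> imp I x y = unit I},
    compl = (\<lambda>x\<in>carr I. the_elem (imp I x (zero I))),
    bottom = zero I,
    topmost = the_elem (unit I)\<rparr>"

end

theory Submission
  imports Defs
begin

text \<open>
  For (i), if \<open>y \<or> t = 1\<close> with \<open>t \<le> y'\<close>, then the orthomodular law gives \<open>t = y'\<close>; a maximal
  lower bound \<open>t\<close> of \<open>x'\<close> and \<open>y'\<close> exists by finite height, so \<open>x \<rightarrow> y = 1\<close> forces \<open>y' \<le> x'\<close>.
  For (ii), the point is that \<open>(a \<rightarrow> b) \<rightarrow> b\<close> is a singleton, hence the join of \<open>a\<close> and \<open>b\<close>,
  whenever \<open>a \<le> b'\<close>. Write \<open>S(a,b)\<close> for this set. O7 yields \<open>s \<in> S(a,b)\<close> with \<open>b \<le> s\<close>, O6 for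
  \<open>b \<le> a'\<close> gives \<open>S(s',b) = {a'}\<close>, and then O6 for \<open>b \<le> s\<close> gives \<open>S(a,b) = {s}\<close>.
\<close>

section \<open>Suprema and maximal elements in a partial order\<close>

lemma join_eq:
  assumes "antisym r" and s: "is_supremum r {x, y} s"
  shows "join r x y = s"
  unfolding join_def
proof (rule the_equality)
  show "is_supremum r {x, y} s" by (fact s)
next
  fix t assume "is_supremum r {x, y} t"
  with assms show "t = s"
    unfolding is_supremum_def antisym_def by blast
qed

text \<open>Zorn's lemma applies because every chain in \<open>B\<close> is also a chain of
  \<open>r\<close>, hence finite, and a nonempty finite chain is bounded by its own greatest
  element.\<close>

lemma maximal_elements_nonempty:
  assumes po: "partial_order_on A r" and fin: "\<forall>C\<in>Chains r. finite C"
    and "B \<subseteq> A" and "B \<noteq> {}"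
  shows "maximal_elements r B \<noteq> {}"
proof -
  have refl: "refl_on A r" and trans: "trans r" and antisym: "antisym r"
    using po by (auto simp: partial_order_on_def preorder_on_def)
  let ?R = "relation_of (\<lambda>a b. (a, b) \<in> r) B"
  have "\<exists>m\<in>B. \<forall>a\<in>B. (m, a) \<in> r \<longrightarrow> a = m"
  proof (rule predicate_Zorn)
    show "partial_order_on B ?R"
      using refl trans antisym \<open>B \<subseteq> A\<close>
      unfolding partial_order_on_def preorder_on_def relation_of_def refl_on_def trans_def antisym_def
      by blast
  next
    fix C assume C: "C \<in> Chains ?R"
    then have sub: "C \<subseteq> B" and chain: "C \<in> Chains r"
      by (auto simp: Chains_def relation_of_def)
    show "\<exists>u\<in>B. \<forall>a\<in>C. (a, u) \<in> r"
    proof (cases "C = {}")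
      case True
      then show ?thesis using \<open>B \<noteq> {}\<close> by blast
    next
      case False
      moreover have "finite C" using fin chain by blast
      moreover have "transp_on C (\<lambda>a b. (a, b) \<in> r)"
        using trans unfolding transp_on_def trans_def by blast
      moreover have "totalp_on C (\<lambda>a b. (a, b) \<in> r)"
        using chain unfolding totalp_on_def Chains_def by blast
      ultimately obtain g where g: "g \<in> C" "\<forall>x\<in>C. x \<noteq> g \<longrightarrow> (x, g) \<in> r"
        using Finite_Set.bex_greatest_element[of C "\<lambda>a b. (a, b) \<in> r"] by blast
      \<comment> \<open>The greatest-element property of \<open>g\<close> covers only
        \<open>x \<noteq> g\<close>; reflexivity supplies the remaining case.\<close>
      have "(g, g) \<in> r"
        using refl g(1) sub \<open>B \<subseteq> A\<close> unfolding refl_on_def by blast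
      with g sub show ?thesis by (metis subsetD)
    qed
  qed
  then show ?thesis unfolding maximal_elements_def by blast
qed

section \<open>From an orthomodular poset to its implication and back\<close>

context orthomodular_poset
begin

abbreviation le (infix "\<sqsubseteq>" 50) where "x \<sqsubseteq> y \<equiv> (x, y) \<in> ord_rel P"

lemma ord_refl: "x \<in> elems P \<Longrightarrow> x \<sqsubseteq> x"
  using partial_order by (auto simp: partial_order_on_def preorder_on_def refl_on_def)

lemma ord_mem: "x \<sqsubseteq> y \<Longrightarrow> x \<in> elems P \<and> y \<in> elems P"
  using partial_order by (auto simp: partial_order_on_def preorder_on_def)

lemma ord_trans: "x \<sqsubseteq> y \<Longrightarrow> y \<sqsubseteq> z \<Longrightarrow> x \<sqsubseteq> z"
  using partial_order by (auto simp: partial_order_on_def preorder_on_def dest: transD)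

lemma antisym_ord: "antisym (ord_rel P)"
  using partial_order by (auto simp: partial_order_on_def)

lemma ord_antisym: "x \<sqsubseteq> y \<Longrightarrow> y \<sqsubseteq> x \<Longrightarrow> x = y"
  using antisym_ord by (auto dest: antisymD)

text \<open>\<open>Above\<close> and \<open>Under\<close> range over the field of the relation; this
  turns them into sets of bounds in the carrier.\<close>

lemma Field_ord: "Field (ord_rel P) = elems P"
  using ord_refl ord_mem by (auto simp: Field_def)

lemma compl_mem: "x \<in> elems P \<Longrightarrow> compl P x \<in> elems P"
  using compl_fun by blast

lemma compl_bottom: "compl P (bottom P) = topmost P"
proof (rule ord_antisym)
  show "compl P (bottom P) \<sqsubseteq> topmost P"
    by (simp add: topmost_greatest compl_mem bottom_mem)
  have "bottom P \<sqsubseteq> compl P (topmost P)"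
    by (simp add: bottom_least compl_mem topmost_mem)
  then show "topmost P \<sqsubseteq> compl P (bottom P)"
    using compl_antitone compl_involution topmost_mem by fastforce
qed

lemma compl_topmost: "compl P (topmost P) = bottom P"
  using compl_bottom compl_involution[OF bottom_mem] by simp

lemma join_bottom: "x \<in> elems P \<Longrightarrow> join (ord_rel P) (bottom P) x = x"
  by (rule join_eq[OF antisym_ord])
    (auto simp: is_supremum_def Above_def Field_ord ord_refl bottom_least)

lemma join_compl: "x \<in> elems P \<Longrightarrow> join (ord_rel P) x (compl P x) = topmost P"
  by (rule join_eq[OF antisym_ord sup_compl])

text \<open>The common lower bounds of a comparable pair form the down-set of the smaller element.
  This reduces \<open>x \<rightarrow> y\<close> to a single value when \<open>x \<le> y\<close> and
  when \<open>y = 0\<close>.\<close>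

lemma maximal_Under_comparable:
  assumes "b \<sqsubseteq> a"
  shows "maximal_elements (ord_rel P) (Under (ord_rel P) {a, b}) = {b}"
proof -
  have "Under (ord_rel P) {a, b} = {c. c \<sqsubseteq> b}"
    using ord_mem ord_trans[OF _ assms] by (auto simp: Under_def Field_ord)
  then show ?thesis
    using ord_refl[of b] ord_mem[OF assms] ord_antisym by (auto simp: maximal_elements_def)
qed

text \<open>The orthomodular law for \<open>t \<le> y'\<close> reads
  \<open>(y'' \<or> t)' \<or> t = y'\<close>. Its inner join is \<open>y \<or> t = 1\<close>, so the
  left side is \<open>0 \<or> t = t\<close>.\<close>

lemma orthogonal_join_topmost:
  assumes "t \<sqsubseteq> compl P y" and y: "y \<in> elems P" and "join (ord_rel P) y t = topmost P"
  shows "t = compl P y"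
  using orthomodular_law[OF assms(1)] assms(3) compl_involution[OF y] compl_topmost
    join_bottom ord_mem[OF assms(1)] by simp

lemma imp_to_implication:
  assumes "x \<in> elems P" "y \<in> elems P"
  shows "imp (to_implication P) x y = join (ord_rel P) y `
    maximal_elements (ord_rel P) (Under (ord_rel P) {compl P x, compl P y})"
  using assms by (auto simp: to_implication_def)

text \<open>Antitony gives \<open>y' \<le> x'\<close>, so \<open>y'\<close> is the only maximal
  common lower bound and \<open>y \<or> y' = 1\<close> the only value.\<close>

lemma imp_eq_topmost_if_le:
  assumes "x \<sqsubseteq> y"
  shows "imp (to_implication P) x y = {topmost P}"
  using assms ord_mem[OF assms]
  by (simp add: imp_to_implication maximal_Under_comparable compl_antitone join_compl)

lemma le_if_imp_eq_topmost:
  assumes "poset_finite_height P" "x \<in> elems P" "y \<in> elems P"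
    and imp: "imp (to_implication P) x y = {topmost P}"
  shows "x \<sqsubseteq> y"
proof -
  let ?L = "Under (ord_rel P) {compl P x, compl P y}"
  \<comment> \<open>The bottom element witnesses that there is a common lower bound at all, so that
    a maximal one can be chosen.\<close>
  have "bottom P \<in> ?L"
    using assms(2,3) by (simp add: Under_def Field_ord bottom_mem bottom_least compl_mem)
  moreover have "?L \<subseteq> elems P" by (auto simp: Under_def Field_ord)
  ultimately have "maximal_elements (ord_rel P) ?L \<noteq> {}"
    using maximal_elements_nonempty[OF partial_order] assms(1)
    unfolding poset_finite_height_def by blast
  then obtain t where t: "t \<in> maximal_elements (ord_rel P) ?L" by blast
  then have tx: "t \<sqsubseteq> compl P x" and ty: "t \<sqsubseteq> compl P y"
    by (auto simp: maximal_elements_def Under_def)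
  have "join (ord_rel P) y t = topmost P"
    using imp t imp_to_implication[OF assms(2,3)] by blast
  then have "t = compl P y" using orthogonal_join_topmost[OF ty assms(3)] by simp
  with tx have "compl P y \<sqsubseteq> compl P x" by simp
  from compl_antitone[OF this] show ?thesis
    using assms(2,3) by (simp add: compl_involution)
qed

lemma unit_to_implication: "unit (to_implication P) = {topmost P}"
proof -
  have "unit (to_implication P) = imp (to_implication P) (bottom P) (bottom P)"
    by (simp add: unit_def to_implication_def)
  then show ?thesis by (simp add: imp_eq_topmost_if_le ord_refl bottom_mem)
qed

text \<open>Since \<open>0' = 1\<close>, the only maximal common lower bound is \<open>x'\<close>,
  and \<open>0 \<or> x' = x'\<close>. This is how the complement is recovered.\<close>

lemma imp_bottom:
  assumes "x \<in> elems P"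
  shows "imp (to_implication P) x (bottom P) = {compl P x}"
proof -
  have "maximal_elements (ord_rel P) (Under (ord_rel P) {compl P x, topmost P}) = {compl P x}"
    using maximal_Under_comparable[OF topmost_greatest[OF compl_mem[OF assms]]]
    by (simp add: insert_commute)
  then show ?thesis
    using assms by (simp add: imp_to_implication bottom_mem compl_bottom join_bottom compl_mem)
qed

lemma to_poset_to_implication:
  assumes "poset_finite_height P"
  shows "to_poset (to_implication P) = P"
proof -
  have carr: "carr (to_implication P) = elems P" and zero: "zero (to_implication P) = bottom P"
    by (simp_all add: to_implication_def)
  have ord_rel: "ord_rel (to_poset (to_implication P)) = ord_rel P"
  proof (rule set_eqI, unfold split_paired_all)
    fix x y
    have "(x, y) \<in> ord_rel (to_poset (to_implication P)) \<longleftrightarrow>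
      x \<in> elems P \<and> y \<in> elems P \<and> imp (to_implication P) x y = {topmost P}"
      by (simp add: to_poset_def carr unit_to_implication)
    also have "\<dots> \<longleftrightarrow> x \<sqsubseteq> y"
      using ord_mem[of x y] imp_eq_topmost_if_le[of x y] le_if_imp_eq_topmost[OF assms, of x y]
      by blast
    finally show "(x, y) \<in> ord_rel (to_poset (to_implication P)) \<longleftrightarrow> x \<sqsubseteq> y" .
  qed
  have compl: "compl (to_poset (to_implication P)) = compl P"
  proof
    fix x
    show "compl (to_poset (to_implication P)) x = compl P x"
      \<comment> \<open>Off the carrier both complements are \<open>undefined\<close>.\<close>
      using PiE_arb[OF compl_fun, of x]
      by (cases "x \<in> elems P") (simp_all add: to_poset_def carr zero imp_bottom)
  qed
  have "elems (to_poset (to_implication P)) = elems P"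
    and "bottom (to_poset (to_implication P)) = bottom P"
    and "topmost (to_poset (to_implication P)) = topmost P"
    by (simp_all add: to_poset_def carr zero unit_to_implication)
  from this(1) ord_rel compl this(2,3) show ?thesis
    by (rule bounded_poset_compl.equality) simp
qed

end

section \<open>Complements and join terms in an implication orthomodular poset\<close>

context implication_orthomodular_poset
begin

abbreviation le (infix "\<sqsubseteq>" 50) where "x \<sqsubseteq> y \<equiv> imp I x y = unit I"

text \<open>Taking the complement from \<open>to_poset I\<close> lets the elementwise reading of the
  axioms transfer to the constructed poset unchanged.\<close>

abbreviation cmp where "cmp x \<equiv> compl (to_poset I) x"

lemma imp_mem: "x \<in> carr I \<Longrightarrow> y \<in> carr I \<Longrightarrow> a \<in> imp I x y \<Longrightarrow> a \<in> carr I"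
  using imp_fun by (blast dest: PiE_mem)

lemma imp_nonempty: "x \<in> carr I \<Longrightarrow> y \<in> carr I \<Longrightarrow> imp I x y \<noteq> {}"
  using imp_fun by (blast dest: PiE_mem)

text \<open>For any \<open>a\<close> in \<open>x \<rightarrow> 0\<close>, O4 for \<open>x\<close>
  makes \<open>a \<rightarrow> 0\<close> a nonempty subset of \<open>{x}\<close>, hence
  \<open>{x}\<close>; then O4 for \<open>a\<close> turns \<open>x \<rightarrow> 0\<close> into
  \<open>{a}\<close>.\<close>

lemma imp_zero:
  assumes x: "x \<in> carr I"
  shows "imp I x (zero I) = {cmp x}"
proof -
  obtain a where a: "a \<in> imp I x (zero I)"
    using imp_nonempty[OF x zero_mem] by blast
  then have ac: "a \<in> carr I" using imp_mem[OF x zero_mem] by blast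
  have "imp I a (zero I) \<subseteq> {x}"
    using O4[OF x] a by (auto simp: neg_def imps_def)
  then have "imp I a (zero I) = {x}"
    using imp_nonempty[OF ac zero_mem] by blast
  then have "imp I x (zero I) = {a}"
    using O4[OF ac] by (simp add: neg_def imps_def)
  then show ?thesis using x by (simp add: to_poset_def)
qed

lemma neg_singleton: "x \<in> carr I \<Longrightarrow> neg I {x} = {cmp x}"
  by (simp add: neg_def imps_def imp_zero)

lemma cmp_mem: "x \<in> carr I \<Longrightarrow> cmp x \<in> carr I"
  using imp_mem[OF _ zero_mem, of x "cmp x"] by (simp add: imp_zero)

lemma cmp_cmp: "x \<in> carr I \<Longrightarrow> cmp (cmp x) = x"
  using O4[of x] by (simp add: neg_singleton cmp_mem)

lemma imp1_neg: "x \<in> carr I \<Longrightarrow> imp1 I {u} (neg I {x}) \<longleftrightarrow> u \<sqsubseteq> cmp x"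
  by (simp add: imp1_def neg_singleton)

lemma cmp_antitone: "x \<in> carr I \<Longrightarrow> y \<in> carr I \<Longrightarrow> x \<sqsubseteq> y \<Longrightarrow> cmp y \<sqsubseteq> cmp x"
  using O5[OF _ _ zero_mem, of x y] by (simp add: imp1_def imp_zero)

lemma orthogonal_sym:
  "x \<in> carr I \<Longrightarrow> y \<in> carr I \<Longrightarrow> x \<sqsubseteq> cmp y \<Longrightarrow> y \<sqsubseteq> cmp x"
  using cmp_antitone[of x "cmp y"] by (simp add: cmp_mem cmp_cmp)

lemma imps_mem:
  "A \<subseteq> carr I \<Longrightarrow> B \<subseteq> carr I \<Longrightarrow> imps I A B \<subseteq> carr I"
  using imp_mem unfolding imps_def by blast

lemma imps_nonempty:
  assumes "A \<subseteq> carr I" "B \<subseteq> carr I" "A \<noteq> {}" "B \<noteq> {}"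
  shows "imps I A B \<noteq> {}"
proof -
  obtain a b where "a \<in> A" "b \<in> B" using assms(3,4) by blast
  moreover from this have "imp I a b \<noteq> {}"
    using imp_nonempty[OF subsetD[OF assms(1)] subsetD[OF assms(2)]] by blast
  ultimately show ?thesis unfolding imps_def by blast
qed

text \<open>The implicational formula \<open>(x \<rightarrow> y) \<rightarrow> y\<close> for a join,
  still set-valued here; it is shown to be the actual join for orthogonal arguments.\<close>

definition pseudojoin :: "'a \<Rightarrow> 'a \<Rightarrow> 'a set" where
  "pseudojoin x y = imps I (imp I x y) {y}"

lemma pseudojoin_mem: "x \<in> carr I \<Longrightarrow> y \<in> carr I \<Longrightarrow> pseudojoin x y \<subseteq> carr I"
  unfolding pseudojoin_def by (intro imps_mem subsetI) (erule imp_mem[rotated 2], simp_all)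

lemma pseudojoin_nonempty: "x \<in> carr I \<Longrightarrow> y \<in> carr I \<Longrightarrow> pseudojoin x y \<noteq> {}"
  unfolding pseudojoin_def
  by (intro imps_nonempty subsetI imp_nonempty) (erule imp_mem[rotated 2], simp_all)

text \<open>O6 says that the union of the sets \<open>pseudojoin (cmp s) x\<close>, over all
  \<open>s\<close> in \<open>pseudojoin (cmp y) x\<close>, is \<open>{y}\<close>. Each of them is
  nonempty, so each equals \<open>{y}\<close>.\<close>

lemma pseudojoin_orthomodular:
  assumes x: "x \<in> carr I" and y: "y \<in> carr I" and "x \<sqsubseteq> y"
    and s: "s \<in> pseudojoin (cmp y) x"
  shows "pseudojoin (cmp s) x = {y}"
proof -
  have "s \<in> carr I" using pseudojoin_mem[OF cmp_mem[OF y] x] s by blast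
  note sc = this cmp_mem[OF this]
  have "imps I (imps I (neg I (pseudojoin (cmp y) x)) {x}) {x} = {y}"
    using O6[OF x y \<open>x \<sqsubseteq> y\<close>] y by (simp add: neg_singleton pseudojoin_def imps_def)
  moreover have "cmp s \<in> neg I (pseudojoin (cmp y) x)"
    using s imp_zero[OF sc(1)] by (auto simp: neg_def imps_def)
  ultimately have "pseudojoin (cmp s) x \<subseteq> {y}"
    unfolding pseudojoin_def imps_def by blast
  then show ?thesis using pseudojoin_nonempty[OF sc(2) x] by blast
qed

lemma pseudojoin_singleton:
  assumes x: "x \<in> carr I" and y: "y \<in> carr I" and "x \<sqsubseteq> cmp y"
  shows "\<exists>s. pseudojoin x y = {s}"
proof -
  have "imp1 I {x} (neg I {y})" using assms by (simp add: imp1_neg)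
  then have "imp1 I {y} (pseudojoin x y)"
    using O7[OF x y] unfolding pseudojoin_def by simp
  then obtain s where s: "s \<in> pseudojoin x y" and "y \<sqsubseteq> s"
    unfolding imp1_def by blast
  have sc: "s \<in> carr I" using pseudojoin_mem[OF x y] s by blast
  have "pseudojoin (cmp s) y = {cmp x}"
    by (rule pseudojoin_orthomodular[OF y cmp_mem[OF x] orthogonal_sym[OF assms]])
      (simp only: cmp_cmp[OF x] s)
  \<comment> \<open>In this second use of O6, \<open>cmp x\<close> is the element drawn from
    \<open>pseudojoin (cmp s) y\<close>, and its complement is \<open>x\<close> again.\<close>
  then have "pseudojoin x y = {s}"
    using pseudojoin_orthomodular[OF y sc \<open>y \<sqsubseteq> s\<close>, of "cmp x"]
    by (simp only: cmp_cmp[OF x] singletonI)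
  then show ?thesis ..
qed

section \<open>From an implication orthomodular poset to its order and back\<close>

lemma to_poset_rel: "(x, y) \<in> ord_rel (to_poset I) \<longleftrightarrow> x \<in> carr I \<and> y \<in> carr I \<and> x \<sqsubseteq> y"
  by (simp add: to_poset_def)

lemma antisym_to_poset: "antisym (ord_rel (to_poset I))"
  using O2 by (auto simp: antisym_def to_poset_rel)

lemma Field_to_poset: "Field (ord_rel (to_poset I)) = carr I"
proof
  show "carr I \<subseteq> Field (ord_rel (to_poset I))"
  proof
    fix x assume "x \<in> carr I"
    then have "(x, x) \<in> ord_rel (to_poset I)" using O1 by (simp add: to_poset_rel)
    then show "x \<in> Field (ord_rel (to_poset I))" by (rule FieldI1)
  qed
qed (auto simp: Field_def to_poset_rel)

text \<open>Once the set is a singleton \<open>{s}\<close>, O7 makes \<open>s\<close> an upper bound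
  and O8 makes it the least one.\<close>

lemma pseudojoin_eq_join:
  assumes x: "x \<in> carr I" and y: "y \<in> carr I" and "x \<sqsubseteq> cmp y"
  shows "pseudojoin x y = {join (ord_rel (to_poset I)) x y}"
proof -
  obtain s where s: "pseudojoin x y = {s}"
    using pseudojoin_singleton[OF assms] by blast
  then have sc: "s \<in> carr I" using pseudojoin_mem[OF x y] by blast
  have orth: "imp1 I {x} (neg I {y})" using assms by (simp add: imp1_neg)
  have upper: "x \<sqsubseteq> s" "y \<sqsubseteq> s"
    using O7[OF x y orth] unfolding pseudojoin_def[symmetric] s imp1_def by simp_all
  have least: "s \<sqsubseteq> z" if "z \<in> carr I" "x \<sqsubseteq> z" "y \<sqsubseteq> z" for z
    using O8[OF x y that(1) orth that(2,3)] unfolding pseudojoin_def[symmetric] s imp1_def by simp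
  have "is_supremum (ord_rel (to_poset I)) {x, y} s"
    unfolding is_supremum_def Above_def Field_to_poset
    by (simp add: upper least x y sc to_poset_rel)
  then show ?thesis using s join_eq[OF antisym_to_poset] by blast
qed

text \<open>As \<open>imp1 I {w} (neg I {x})\<close> means \<open>w \<le> x'\<close>, the side
  conditions on \<open>u\<close> in \<open>condition_C\<close> describe exactly the maximal common
  lower bounds used by \<open>to_implication\<close>.\<close>

lemma maximal_Under_to_poset:
  assumes "x \<in> carr I" "y \<in> carr I"
  shows "u \<in> maximal_elements (ord_rel (to_poset I)) (Under (ord_rel (to_poset I)) {cmp x, cmp y})
    \<longleftrightarrow> u \<in> carr I \<and> imp1 I {u} (neg I {x}) \<and> imp1 I {u} (neg I {y}) \<and>
      (\<forall>w\<in>carr I. u \<sqsubseteq> w \<and> imp1 I {w} (neg I {x}) \<and> imp1 I {w} (neg I {y}) \<longrightarrow> u = w)"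
    (is "u \<in> maximal_elements ?r ?L \<longleftrightarrow> _")
proof -
  have L: "w \<in> ?L \<longleftrightarrow> w \<in> carr I \<and> imp1 I {w} (neg I {x}) \<and> imp1 I {w} (neg I {y})" for w
    unfolding Under_def Field_to_poset imp1_neg[OF assms(1)] imp1_neg[OF assms(2)]
    by (simp add: to_poset_rel cmp_mem assms cong: conj_cong)
  have "u \<in> maximal_elements ?r ?L \<longleftrightarrow> u \<in> ?L \<and> (\<forall>w. w \<in> ?L \<longrightarrow> (u, w) \<in> ?r \<longrightarrow> u = w)"
    by (simp add: maximal_elements_def Ball_def eq_commute[of u])
  then show ?thesis unfolding L to_poset_rel
    by (cases "u \<in> carr I") (simp_all add: Ball_def conj_ac flip: imp_conjL)
qed

lemma imp_eq_joins:
  assumes C: "condition_C I" and x: "x \<in> carr I" and y: "y \<in> carr I"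
  shows "imp I x y = {join (ord_rel (to_poset I)) y t | t.
    t \<in> maximal_elements (ord_rel (to_poset I)) (Under (ord_rel (to_poset I)) {cmp x, cmp y})}"
    (is "_ = {_ | t. t \<in> ?M}")
proof -
  have "imp I x y = \<Union> {pseudojoin y u | u. u \<in> ?M}"
    unfolding maximal_Under_to_poset[OF x y] pseudojoin_def
    by (rule C[unfolded condition_C_def, rule_format, OF x y])
  moreover have "pseudojoin y u = {join (ord_rel (to_poset I)) y u}" if "u \<in> ?M" for u
  proof (rule pseudojoin_eq_join[OF y])
    show u: "u \<in> carr I" using that unfolding maximal_Under_to_poset[OF x y] by blast
    have "u \<sqsubseteq> cmp y"
      using that unfolding maximal_Under_to_poset[OF x y] imp1_neg[OF y] by blast
    then show "y \<sqsubseteq> cmp u" by (rule orthogonal_sym[OF u y])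
  qed
  ultimately have "imp I x y = (\<Union>u\<in>?M. {join (ord_rel (to_poset I)) y u})"
    by (simp add: Setcompr_eq_image)
  then show ?thesis by blast
qed

lemma to_implication_to_poset:
  assumes "condition_C I"
  shows "to_implication (to_poset I) = I"
proof -
  have carr: "elems (to_poset I) = carr I" and zero: "bottom (to_poset I) = zero I"
    by (simp_all add: to_poset_def)
  have imp: "imp (to_implication (to_poset I)) = imp I"
  proof (intro ext)
    fix x y
    \<comment> \<open>Extensionality is curried: outside the carrier in the first argument the whole
      function \<open>imp I x\<close> is \<open>undefined\<close>, in the second only its value
      is.\<close>
    consider "x \<notin> carr I" | "x \<in> carr I" "y \<notin> carr I" | "x \<in> carr I" "y \<in> carr I"
      by blast
    then show "imp (to_implication (to_poset I)) x y = imp I x y"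
    proof cases
      case 1
      then show ?thesis
        using PiE_arb[OF imp_fun 1] by (simp add: to_implication_def carr)
    next
      case 2
      then show ?thesis
        using PiE_arb[OF PiE_mem[OF imp_fun 2(1)] 2(2)] by (simp add: to_implication_def carr)
    next
      case 3
      then show ?thesis
        using imp_eq_joins[OF assms 3] by (simp add: to_implication_def carr)
    qed
  qed
  have "carr (to_implication (to_poset I)) = carr I"
    and "zero (to_implication (to_poset I)) = zero I"
    by (simp_all add: to_implication_def carr zero)
  from this(1) imp this(2) show ?thesis
    by (rule implication_structure.equality) simp
qed

end

theorem theorem2p7:
  "(\<forall>P :: 'a bounded_poset_compl. orthomodular_poset P \<and> poset_finite_height P
      \<longrightarrow> to_poset (to_implication P) = P) \<and>
   (\<forall>I :: 'b implication_structure.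
      implication_orthomodular_poset I \<and> impl_finite_height I \<and> condition_C I
      \<longrightarrow> to_implication (to_poset I) = I)"
  by (intro conjI allI impI; elim conjE)
    (erule (1) orthomodular_poset.to_poset_to_implication,
      erule (1) implication_orthomodular_poset.to_implication_to_poset)

end
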